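(* Consider the system $x_{k+1}=Ax_k+Bu_k+Hw_k$ with observations $z_k=q(x_k)$, a perception map $p$, a known matrix $C$, and perception errors $e_k=p(z_k)-Cx_k$, i.e. $\boldsymbol e=p(\boldsymbol z)-C\boldsymbol x$. Let $\mathcal{S}_0=\{(x_i,z_i)\}_{i=1}^{N_0}$ be the training data, with $z_i=q(x_i)$. Suppose that: (i) the function $x\mapsto p(q(x))-Cx$ is locally $S$-slope bounded with a radius of $r$ around the training datapoints; (ii) the system responses $\{\boldsymbol\Phi_{xw},\boldsymbol\Phi_{xe},\boldsymbol\Phi_{uw},\boldsymbol\Phi_{ue}\}$ lie in the affine space $\mathcal{A}$ defined by the dynamics $(A,B,C)$, $\boldsymbol K$ is the associated controller, and the state trajectory $\boldsymbol x$ is the one achieved by the control law $\boldsymbol u=\boldsymbol K p(\boldsymbol z)$ and driven by the noise process $\boldsymbol w$; (iii) the training error is bounded, i.e. $\|p(z_d)-Cx_d\|\le R_0$ for all $(x_d,z_d)\in\mathcal{S}_0$. Let $\boldsymbol x_d=\{x_{d,k}\}_{k\ge0}$ be a target trajectory made of training states (each $x_{d,k}$ is the state of a pair in $\mathcal{S}_0$), and let $\|\widehat{\boldsymbol x}-\boldsymbol x_d\|=\|\boldsymbol\Phi_{xw}H\boldsymbol w-\boldsymbol x_d\|$ be the nominal closeness, i.e. the deviation from the target trajectory in the absence of measurement errors. Then as long as $$\|\boldsymbol\Phi_{xe}\|\le\frac{1-\frac1r\|\widehat{\boldsymbol x}-\boldsymbol x_d\|}{S+\frac{R_0}{r}},$$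 the perception errors remain bounded, $$\|p(\boldsymbol z)-C\boldsymbol x\|\le\frac{\|\widehat{\boldsymbol x}-\boldsymbol x_d\|+R_0}{1-S\|\boldsymbol\Phi_{xe}\|}:=\gamma,$$ and the closed-loop trajectory lies within $\mathcal{X}_\gamma$.
   Context: Here $x_k\in\mathbb{R}^n$ is the state, $u_k\in\mathbb{R}^m$ the control input, $w_k$ the disturbance, $z_k\in\mathbb{R}^M$ the observation; $A,B,H$ are known real matrices of compatible sizes, $C\in\mathbb{R}^{\ell\times n}$, $q:\mathbb{R}^n\to\mathbb{R}^M$ is the (unknown) generative model and $p:\mathbb{R}^M\to\mathbb{R}^\ell$. Norms and signals: boldface denotes infinite-horizon signals (sequences indexed by $k\ge0$) and linear convolution operators. Given a norm $\|\cdot\|$ on vectors, $\|\boldsymbol x\|=\sup_k\|x_k\|$ for signals and $\|\boldsymbol\Phi\|=\sup_{\|\boldsymbol w\|\le1}\|\boldsymbol\Phi\boldsymbol w\|$ for operators. For a function $f$, $f(\boldsymbol x)$ is the signal $\{f(x_k)\}_k$. $B_r(x_0)=\{x:\|x-x_0\|\le r\}$. A function $f$ is locally $S$-slope bounded for a radius $r$ around $x_0$ if $\|f(x)-f(x_0)\|\le S\|x-x_0\|$ for all $x\in B_r(x_0)$. Safe set: $$\mathcal{X}_\gamma=\bigcup_{(x_d,z_d)\in\mathcal{S}_0}\{x\in B_r(x_d):\|p(z_d)-Cx_d\|+S\|x-x_d\|\le\gamma\}.$$ System responses: matrix sequences $\Phi_{xw}(t),\Phi_{xe}(t),\Phi_{uw}(t),\Phi_{ue}(t)$,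 $t\ge1$, acting as convolution operators, with $z$-transforms $\boldsymbol\Phi_{xw}$, $\boldsymbol\Phi_{xe}$, $\boldsymbol\Phi_{uw}$, $\boldsymbol\Phi_{ue}$. Write $\boldsymbol\Phi=\begin{bmatrix}\boldsymbol\Phi_{xw}&\boldsymbol\Phi_{xe}\\ \boldsymbol\Phi_{uw}&\boldsymbol\Phi_{ue}\end{bmatrix}$. The affine space $\mathcal{A}$ defined by $(A,B,C)$ is the set of $\boldsymbol\Phi$ satisfying $$\begin{bmatrix}zI-A&-B\end{bmatrix}\boldsymbol\Phi=\begin{bmatrix}I&0\end{bmatrix},\qquad\boldsymbol\Phi\begin{bmatrix}zI-A\\ -C\end{bmatrix}=\begin{bmatrix}I\\ 0\end{bmatrix}.$$ The associated controller is $\boldsymbol K=\boldsymbol\Phi_{ue}-\boldsymbol\Phi_{uw}\boldsymbol\Phi_{xw}^{-1}\boldsymbol\Phi_{xe}$. With measurements $y_k=p(z_k)=Cx_k+e_k$ and $\boldsymbol u=\boldsymbol K\boldsymbol y$, the closed loop satisfies $$\begin{bmatrix}x_k\\ u_k\end{bmatrix}=\sum_{t=1}^k\begin{bmatrix}\Phi_{xw}(t)&\Phi_{xe}(t)\\ \Phi_{uw}(t)&\Phi_{ue}(t)\end{bmatrix}\begin{bmatrix}Hw_{k-t}\\ e_{k-t}\end{bmatrix}.$$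
   Formalization: The printed γ fails for S>1 (A=B=0, C=H=1, Φ_xe=0, K=0, error Sx, R_0=0, constant noise). The formal theorem proves the bound and safe-set claim with numerator S‖x̂−x_d‖+R_0 for every S, and the printed γ when S≤1. *)

theory Defs
  imports "HOL-Analysis.Analysis" "HOL-Computational_Algebra.Formal_Laurent_Series"
begin

unbundle no fps_syntax  \<comment> \<open>\<open>$\<close> is vector indexing throughout\<close>

definition vector_norm :: "('a::real_vector \<Rightarrow> real) \<Rightarrow> bool" where
  "vector_norm N \<longleftrightarrow>
     (\<forall>x. N x \<ge> 0) \<and> (\<forall>x. N x = 0 \<longleftrightarrow> x = 0) \<and>
     (\<forall>c x. N (c *\<^sub>R x) = \<bar>c\<bar> * N x) \<and> (\<forall>x y. N (x + y) \<le> N x + N y)"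

text \<open>Suprema are taken in the extended reals, so that unbounded signals and operators have
  norm \<open>\<infinity>\<close>.\<close>

definition signal_norm :: "('a \<Rightarrow> real) \<Rightarrow> (nat \<Rightarrow> 'a) \<Rightarrow> ereal" where
  "signal_norm N x = (SUP k. ereal (N (x k)))"

text \<open>A system response is a sequence of matrices \<open>\<Phi>(t)\<close> with \<open>t \<ge> 1\<close>; the entry at index 0 is
  never used.\<close>

definition conv :: "(nat \<Rightarrow> real^'b^'a) \<Rightarrow> (nat \<Rightarrow> real^'b) \<Rightarrow> nat \<Rightarrow> real^'a" where
  "conv \<Phi> w k = (\<Sum>t = 1..k. \<Phi> t *v w (k - t))"

text \<open>The norms \<open>N\<close> and \<open>N'\<close> here and below are those on the domain and codomain, respectively.\<close>

definition operator_norm ::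
    "(real^'b \<Rightarrow> real) \<Rightarrow> (real^'a \<Rightarrow> real) \<Rightarrow> (nat \<Rightarrow> real^'b^'a) \<Rightarrow> ereal" where
  "operator_norm N N' \<Phi> = (SUP w\<in>{w. signal_norm N w \<le> 1}. signal_norm N' (conv \<Phi> w))"

text \<open>z-transforms are formal Laurent series in the variable \<open>fls_X\<close>, which stands for
  \<open>1/z\<close>; thus \<open>z\<close> is \<open>fls_X_inv\<close>. Transfer matrices are matrices over the field
  \<open>real fls\<close>.\<close>

definition ztrans_signal :: "(nat \<Rightarrow> real^'a) \<Rightarrow> (real fls)^'a" where
  "ztrans_signal x = (\<chi> i. fps_to_fls (Abs_fps (\<lambda>k. x k $ i)))"

definition ztrans :: "(nat \<Rightarrow> real^'b^'a) \<Rightarrow> (real fls)^'b^'a" where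
  "ztrans \<Phi> = (\<chi> i j. fps_to_fls (Abs_fps (\<lambda>t. if t = 0 then 0 else \<Phi> t $ i $ j)))"

definition const_tf :: "real^'b^'a \<Rightarrow> (real fls)^'b^'a" where
  "const_tf A = map_matrix fls_const A"

definition hcat :: "'c^'a^'r \<Rightarrow> 'c^'b^'r \<Rightarrow> 'c^('a + 'b)^'r" where
  "hcat P Q = (\<chi> i j. case j of Inl a \<Rightarrow> P $ i $ a | Inr b \<Rightarrow> Q $ i $ b)"

definition vcat :: "'c^'s^'a \<Rightarrow> 'c^'s^'b \<Rightarrow> 'c^'s^('a + 'b)" where
  "vcat P Q = (\<chi> i. case i of Inl a \<Rightarrow> P $ a | Inr b \<Rightarrow> Q $ b)"

definition affine_space ::
    "real^'n^'n \<Rightarrow> real^'m^'n \<Rightarrow> real^'n^'l \<Rightarrow> ((real fls)^('n + 'l)^('n + 'm)) set" where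
  "affine_space A B C =
     {\<Phi>. hcat (mat fls_X_inv - const_tf A) (- const_tf B) ** \<Phi> = hcat (mat 1) 0 \<and>
         \<Phi> ** vcat (mat fls_X_inv - const_tf A) (- const_tf C) = vcat (mat 1) 0}"

definition controller ::
    "(nat \<Rightarrow> real^'n^'n) \<Rightarrow> (nat \<Rightarrow> real^'l^'n) \<Rightarrow> (nat \<Rightarrow> real^'n^'m) \<Rightarrow> (nat \<Rightarrow> real^'l^'m)
      \<Rightarrow> (real fls)^'l^'m" where
  "controller \<Phi>xw \<Phi>xe \<Phi>uw \<Phi>ue =
     ztrans \<Phi>ue - ztrans \<Phi>uw ** matrix_inv (ztrans \<Phi>xw) ** ztrans \<Phi>xe"

definition nball :: "('a::real_vector \<Rightarrow> real) \<Rightarrow> real \<Rightarrow> 'a \<Rightarrow> 'a set" where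
  "nball N r x0 = {x. N (x - x0) \<le> r}"

definition locally_slope_bounded ::
    "('a::real_vector \<Rightarrow> real) \<Rightarrow> ('b::real_vector \<Rightarrow> real) \<Rightarrow> real \<Rightarrow> real \<Rightarrow> 'a \<Rightarrow> ('a \<Rightarrow> 'b) \<Rightarrow> bool"
    where
  "locally_slope_bounded N N' S r x0 f \<longleftrightarrow>
     (\<forall>x \<in> nball N r x0. N' (f x - f x0) \<le> S * N (x - x0))"

definition safe_set ::
    "(real^'n \<Rightarrow> real) \<Rightarrow> (real^'l \<Rightarrow> real) \<Rightarrow> (real^'k \<Rightarrow> real^'l) \<Rightarrow> real^'n^'l \<Rightarrow>
     ((real^'n) \<times> (real^'k)) set \<Rightarrow> real \<Rightarrow> real \<Rightarrow> ereal \<Rightarrow> (real^'n) set" where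
  "safe_set N N' p C S0 S r \<gamma> =
     (\<Union>(xd, zd)\<in>S0. {x \<in> nball N r xd. ereal (N' (p zd - C *v xd) + S * N (x - xd)) \<le> \<gamma>})"

end

(* In the z-domain the two affine constraints give x = \<Phi>xw H w + \<Phi>xe e for the closed loop; here
   \<Phi>xw is invertible because z I - A times it is the identity plus a strictly proper matrix. Slope
   boundedness gives |e_k| \<le> S |x_k - x_d,k| + R0 while x_k stays within r of x_d,k, and x_k depends
   only on the errors before time k. Hence induction over time applies, and the small-gain condition
   is exactly what closes it. *)

theory Submission
  imports Defs
begin

unbundle no Formal_Power_Series.fps_syntax
  \<comment> \<open>The unqualified bundle name denotes the one for Laurent series and leaves \<open>fps_nth\<close>
    competing for \<open>$\<close>.\<close>

lemma sum_UNIV_sum_type: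
  fixes f :: "'a::finite + 'b::finite \<Rightarrow> 'c::comm_monoid_add"
  shows "sum f UNIV = (\<Sum>a\<in>UNIV. f (Inl a)) + (\<Sum>b\<in>UNIV. f (Inr b))"
  by (simp add: sum.Plus flip: UNIV_Plus_UNIV)

lemma hcat_mult_vcat: "hcat P Q ** vcat U V = P ** U + Q ** V"
  by (simp add: vec_eq_iff matrix_matrix_mult_def hcat_def vcat_def sum_UNIV_sum_type)

lemma mult_hcat: "P ** hcat U V = hcat (P ** U) (P ** V)"
  by (auto simp: vec_eq_iff matrix_matrix_mult_def hcat_def split: sum.split)

lemma vcat_mult: "vcat P Q ** U = vcat (P ** U) (Q ** U)"
  by (auto simp: vec_eq_iff matrix_matrix_mult_def vcat_def split: sum.split)

lemma hcat_add: "hcat P Q + hcat U V = hcat (P + U) (Q + V)"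
  by (auto simp: vec_eq_iff hcat_def split: sum.split)

lemma hcat_eq_iff: "hcat P Q = hcat U V \<longleftrightarrow> P = U \<and> Q = V"
  by (auto simp: vec_eq_iff hcat_def split_sum_all split: sum.splits)

lemma vcat_eq_iff: "vcat P Q = vcat U V \<longleftrightarrow> P = U \<and> Q = V"
  by (auto simp: vec_eq_iff vcat_def split_sum_all split: sum.splits)

lemma matrix_mult_uminus_left: "(- A) ** B = - (A ** (B :: 'a::ring_1^'p^'n))"
  by (simp add: vec_eq_iff matrix_matrix_mult_def sum_negf)

lemma matrix_mult_uminus_right: "A ** (- B) = - (A ** (B :: 'a::ring_1^'p^'n))"
  by (simp add: vec_eq_iff matrix_matrix_mult_def sum_negf)

lemma affine_space_iff:
  "vcat (hcat Pxw Pxe) (hcat Puw Pue) \<in> affine_space A B C \<longleftrightarrow>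
     (mat fls_X_inv - const_tf A) ** Pxw - const_tf B ** Puw = mat 1 \<and>
     (mat fls_X_inv - const_tf A) ** Pxe - const_tf B ** Pue = 0 \<and>
     Pxw ** (mat fls_X_inv - const_tf A) - Pxe ** const_tf C = mat 1 \<and>
     Puw ** (mat fls_X_inv - const_tf A) - Pue ** const_tf C = 0"
  by (simp add: affine_space_def hcat_mult_vcat mult_hcat vcat_mult hcat_add hcat_eq_iff
      vcat_eq_iff matrix_mult_uminus_left matrix_mult_uminus_right)

section \<open>Invertibility of the state response\<close>

text \<open>The determinant is a polynomial in the entries with integer coefficients, so unital ring
  homomorphisms commute with it. The cases of interest are the embedding of power series into
  Laurent series and the constant-term map.\<close>

lemma det_map_matrix_hom:
  fixes M :: "'a::comm_ring_1^'n^'n" and f :: "'a \<Rightarrow> 'b::comm_ring_1"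
  assumes one: "f 1 = 1" and add: "\<And>a b. f (a + b) = f a + f b"
    and mult: "\<And>a b. f (a * b) = f a * f b"
  shows "det (map_matrix f M) = f (det M)"
proof -
  have zero: "f 0 = 0"
    using add[of 0 0] by simp
  have minus: "f (- a) = - f a" for a
    using add[of a "- a"] by (simp add: zero eq_neg_iff_add_eq_0 add.commute)
  have sum: "f (sum g X) = (\<Sum>x\<in>X. f (g x))" for g :: "('n \<Rightarrow> 'n) \<Rightarrow> 'a" and X
    by (induction X rule: infinite_finite_induct) (simp_all add: zero add)
  have prod: "f (prod g X) = (\<Prod>x\<in>X. f (g x))" for g :: "'n \<Rightarrow> 'a" and X
    by (induction X rule: infinite_finite_induct) (simp_all add: one mult)
  have sign: "f (of_int (sign \<pi>)) = of_int (sign \<pi>)" for \<pi> :: "'n \<Rightarrow> 'n"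
    by (simp add: sign_def one minus)
  show ?thesis
    by (simp add: det_def sum mult prod sign)
qed

lemma const_tf_mult_ztrans: "const_tf B ** ztrans \<Phi> = ztrans (\<lambda>t. B ** \<Phi> t)"
proof -
  have "(\<Sum>k\<in>UNIV. fls_const (B $ i $ k) *
          fps_to_fls (Abs_fps (\<lambda>t. if t = 0 then 0 else \<Phi> t $ k $ j))) =
        fps_to_fls (Abs_fps (\<lambda>t. if t = 0 then 0 else \<Sum>k\<in>UNIV. B $ i $ k * \<Phi> t $ k $ j))" for i j
    by (rule fls_eqI) (auto simp: fls_nth_sum)
  then show ?thesis
    by (simp add: vec_eq_iff matrix_matrix_mult_def const_tf_def ztrans_def cong: if_cong)
qed

text \<open>The determinant is a power series in \<open>1/z\<close> whose constant term is \<open>det (mat 1)\<close>.\<close>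

lemma invertible_mat_1_plus_ztrans: "invertible (mat 1 + ztrans \<Phi>)"
proof -
  define F :: "real fps^'a^'a"
    where "F = mat 1 + (\<chi> i j. Abs_fps (\<lambda>t. if t = 0 then 0 else \<Phi> t $ i $ j))"
  have "mat 1 + ztrans \<Phi> = map_matrix fps_to_fls F"
    by (simp add: vec_eq_iff F_def ztrans_def mat_def map_matrix_def)
  then have "det (mat 1 + ztrans \<Phi>) = fps_to_fls (det F)"
    by (simp add: det_map_matrix_hom fls_times_fps_to_fls)
  moreover have "map_matrix (\<lambda>a. fps_nth a 0) F = mat 1"
    by (simp add: vec_eq_iff F_def mat_def map_matrix_def)
  then have "fps_nth (det F) 0 = 1"
    using det_map_matrix_hom[of "\<lambda>a. fps_nth a 0" F] by simp
  ultimately show ?thesis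
    by (auto simp: invertible_det_nz)
qed

text \<open>Makes \<open>matrix_inv\<close> in \<open>controller\<close> a genuine inverse.
  Inverting \<open>1 + B \<Phi>uw\<close> in the rearranged constraint yields a left inverse of
  \<open>ztrans \<Phi>xw\<close>, which is enough for a square matrix over a field.\<close>

lemma invertible_ztrans_xw:
  assumes "(mat fls_X_inv - const_tf A) ** ztrans \<Phi>xw - const_tf B ** ztrans \<Phi>uw = mat 1"
  shows "invertible (ztrans \<Phi>xw)"
proof -
  have "(mat fls_X_inv - const_tf A) ** ztrans \<Phi>xw = mat 1 + ztrans (\<lambda>t. B ** \<Phi>uw t)"
    using assms by (simp add: const_tf_mult_ztrans algebra_simps)
  moreover obtain L where "L ** (mat 1 + ztrans (\<lambda>t. B ** \<Phi>uw t)) = mat 1"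
    using invertible_mat_1_plus_ztrans by (metis invertible_def)
  ultimately have "(L ** (mat fls_X_inv - const_tf A)) ** ztrans \<Phi>xw = mat 1"
    by (simp flip: matrix_mul_assoc)
  then show ?thesis
    using invertible_left_inverse by blast
qed

section \<open>Convolution and time shift in the z-domain\<close>

lemma fps_to_fls_sum: "fps_to_fls (sum g X) = (\<Sum>x\<in>X. fps_to_fls (g x))"
  by (rule fls_eqI) (auto simp: fls_nth_sum fps_sum_nth)

lemma ztrans_mult_signal: "ztrans \<Phi> *v ztrans_signal w = ztrans_signal (conv \<Phi> w)"
proof -
  have "(\<Sum>j\<in>UNIV. Abs_fps (\<lambda>t. if t = 0 then 0 else \<Phi> t $ i $ j) * Abs_fps (\<lambda>k. w k $ j)) =
        Abs_fps (\<lambda>k. conv \<Phi> w k $ i)" (is "?l = ?r") for i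
  proof (rule fps_ext)
    fix k
    have "fps_nth ?l k =
        (\<Sum>j\<in>UNIV. \<Sum>t=0..k. (if t = 0 then 0 else \<Phi> t $ i $ j) * w (k - t) $ j)"
      by (simp add: fps_sum_nth fps_mult_nth)
    \<comment> \<open>Index 0 drops out because \<open>ztrans\<close> puts 0 there; the Cauchy
      product then has the range of \<open>conv\<close>.\<close>
    also have "\<dots> = (\<Sum>j\<in>UNIV. \<Sum>t=1..k. \<Phi> t $ i $ j * w (k - t) $ j)"
      by (intro sum.cong refl sum.mono_neutral_cong_right) auto
    also have "\<dots> = fps_nth ?r k"
      by (subst sum.swap) (simp add: conv_def matrix_vector_mult_def)
    finally show "fps_nth ?l k = fps_nth ?r k" .
  qed
  then have "(\<Sum>j\<in>UNIV. fps_to_fls (Abs_fps (\<lambda>t. if t = 0 then 0 else \<Phi> t $ i $ j)) *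
          fps_to_fls (Abs_fps (\<lambda>k. w k $ j))) = fps_to_fls (Abs_fps (\<lambda>k. conv \<Phi> w k $ i))" for i
    by (metis (no_types, lifting) fps_to_fls_sum fls_times_fps_to_fls sum.cong)
  then show ?thesis
    by (simp add: vec_eq_iff matrix_vector_mult_def ztrans_def ztrans_signal_def)
qed

lemma ztrans_signal_eq_iff: "ztrans_signal x = ztrans_signal y \<longleftrightarrow> x = y"
  by (auto simp: ztrans_signal_def vec_eq_iff fun_eq_iff fps_eq_iff)

lemma ztrans_signal_add: "ztrans_signal (\<lambda>k. x k + y k) = ztrans_signal x + ztrans_signal y"
  by (auto simp: ztrans_signal_def vec_eq_iff fls_eq_iff)

lemma const_tf_mult_signal: "const_tf A *v ztrans_signal x = ztrans_signal (\<lambda>k. A *v x k)"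
  by (auto simp: const_tf_def ztrans_signal_def vec_eq_iff matrix_vector_mult_def fls_eq_iff fls_nth_sum)

text \<open>Multiplying by z moves every coefficient one place forward, so \<open>x 0\<close> would
  land at exponent -1, outside the range of \<open>ztrans_signal\<close>. This is where the zero
  initial state enters.\<close>

lemma z_mult_signal:
  assumes "x 0 = 0"
  shows "mat fls_X_inv *v ztrans_signal x = ztrans_signal (\<lambda>k. x (Suc k))"
proof -
  have "fls_X_inv * fps_to_fls (Abs_fps (\<lambda>k. x k $ i)) = fps_to_fls (Abs_fps (\<lambda>k. x (Suc k) $ i))" for i
  proof (rule fls_eqI)
    fix n :: int
    consider "n < - 1" | "n = - 1" | "n \<ge> 0" by linarith
    then show "fls_nth (fls_X_inv * fps_to_fls (Abs_fps (\<lambda>k. x k $ i))) n =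
        fls_nth (fps_to_fls (Abs_fps (\<lambda>k. x (Suc k) $ i))) n"
      by cases (use assms in \<open>auto simp: fls_X_inv_times_conv_shift nat_add_distrib\<close>)
  qed
  then show ?thesis
    by (simp add: vec_eq_iff ztrans_signal_def matrix_vector_mult_def mat_def
        if_distrib[of "\<lambda>a. a * _"] cong: if_cong)
qed

section \<open>The closed loop in terms of the system responses\<close>

text \<open>The row equations \<open>xw\<close> and \<open>xe\<close> determine how the control
  input drives the state; the column equation \<open>left\<close>, applied to \<open>X\<close>, then
  expresses \<open>X\<close> through \<open>W\<close> and \<open>E\<close>.\<close>

lemma closed_loop_tf:
  fixes X W :: "'a::field^'n" and U :: "'a^'m" and E :: "'a^'l"
    and P :: "'a^'n^'n" and Bz :: "'a^'m^'n" and Cz :: "'a^'n^'l"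
    and Pxw :: "'a^'n^'n" and Pxe :: "'a^'l^'n" and Puw :: "'a^'n^'m" and Pue :: "'a^'l^'m"
  assumes inv: "invertible Pxw"
    and xw: "P ** Pxw - Bz ** Puw = mat 1" and xe: "P ** Pxe - Bz ** Pue = 0"
    and left: "Pxw ** P - Pxe ** Cz = mat 1"
    and dyn: "P *v X = Bz *v U + W"
    and ctrl: "U = (Pue - Puw ** matrix_inv Pxw ** Pxe) *v (Cz *v X + E)"
  shows "X = Pxw *v W + Pxe *v E"
proof -
  have inv_right: "Pxw ** matrix_inv Pxw = mat 1"
    using someI_ex[OF inv[unfolded invertible_def]] by (simp add: matrix_inv_def)
  define Y where "Y = Cz *v X + E"
  have U: "U = (Pue - Puw ** matrix_inv Pxw ** Pxe) *v Y"
    by (simp add: ctrl Y_def)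
  \<comment> \<open>\<open>V\<close> is what the inverse in the controller makes of the measurement
    \<open>Y\<close>. It turns out to equal \<open>Bz *v U\<close>, and \<open>Pxw\<close> sends it
    to \<open>Pxe *v Y\<close>, which cancels the measurement term coming from
    \<open>left\<close>.\<close>
  define V where "V = matrix_inv Pxw *v (Pxe *v Y)"
  have V: "Pxw *v V = Pxe *v Y"
    using inv_right by (simp add: V_def matrix_vector_mul_assoc matrix_mul_assoc)
  have "Bz *v U = (Bz ** Pue) *v Y - (Bz ** Puw) *v V"
    by (simp add: U V_def matrix_vector_mul_assoc matrix_mul_assoc algebra_simps)
  also have "\<dots> = (P ** Pxe) *v Y - (P ** Pxw) *v V + V"
    using xw xe by (simp add: algebra_simps)
  also have "\<dots> = V"
    using V by (simp flip: matrix_vector_mul_assoc)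
  finally have "Bz *v U = V" .
  have "X = (Pxw ** P - Pxe ** Cz) *v X"
    by (simp add: left)
  also have "\<dots> = Pxw *v (P *v X) - Pxe *v (Y - E)"
    by (simp add: Y_def algebra_simps flip: matrix_vector_mul_assoc)
  also have "\<dots> = Pxw *v W + Pxe *v E"
    using V by (simp add: dyn \<open>Bz *v U = V\<close> algebra_simps)
  finally show ?thesis .
qed

text \<open>Back in the time domain by injectivity of \<open>ztrans_signal\<close>; \<open>v\<close>
  stands for H w. At \<open>k = 0\<close> both convolutions are empty sums, in accordance with
  \<open>x 0 = 0\<close>.\<close>

lemma closed_loop_state:
  assumes "vcat (hcat (ztrans \<Phi>xw) (ztrans \<Phi>xe)) (hcat (ztrans \<Phi>uw) (ztrans \<Phi>ue))
      \<in> affine_space A B C"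
    and "x 0 = 0" and dyn: "\<And>k. x (Suc k) = A *v x k + B *v u k + v k"
    and "ztrans_signal u = controller \<Phi>xw \<Phi>xe \<Phi>uw \<Phi>ue *v ztrans_signal (\<lambda>k. C *v x k + e k)"
  shows "x k = conv \<Phi>xw v k + conv \<Phi>xe e k"
proof -
  note eqs = assms(1)[unfolded affine_space_iff]
  have "(mat fls_X_inv - const_tf A) *v ztrans_signal x
      = const_tf B *v ztrans_signal u + ztrans_signal v"
    by (simp add: algebra_simps z_mult_signal assms(2) dyn const_tf_mult_signal
        flip: ztrans_signal_add)
  then have "ztrans_signal x = ztrans \<Phi>xw *v ztrans_signal v + ztrans \<Phi>xe *v ztrans_signal e"
    using eqs assms(4) by (intro closed_loop_tf[where P = "mat fls_X_inv - const_tf A"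
        and Bz = "const_tf B" and Cz = "const_tf C" and Puw = "ztrans \<Phi>uw" and Pue = "ztrans \<Phi>ue"])
      (auto intro: invertible_ztrans_xw simp: controller_def ztrans_signal_add const_tf_mult_signal)
  then show ?thesis
    by (simp add: ztrans_mult_signal ztrans_signal_eq_iff fun_eq_iff flip: ztrans_signal_add)
qed

section \<open>Signal norms, operator norms and causality\<close>

lemma vector_normD:
  assumes "vector_norm N"
  shows "N x \<ge> 0" "N x = 0 \<longleftrightarrow> x = 0" "N (c *\<^sub>R x) = \<bar>c\<bar> * N x" "N (x + y) \<le> N x + N y"
  using assms by (auto simp: vector_norm_def)

lemma signal_norm_le_iff: "signal_norm N x \<le> a \<longleftrightarrow> (\<forall>k. ereal (N (x k)) \<le> a)"
  by (auto simp: signal_norm_def SUP_le_iff)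

lemma signal_norm_nonneg:
  assumes "vector_norm N"
  shows "signal_norm N x \<ge> 0"
  unfolding signal_norm_def
  by (rule SUP_upper2[of 0]) (use vector_normD(1)[OF assms] in auto)

lemma operator_norm_nonneg:
  assumes "vector_norm N" "vector_norm N'"
  shows "operator_norm N N' \<Phi> \<ge> 0"
  unfolding operator_norm_def
  by (rule SUP_upper2[of "\<lambda>_. 0"])
    (use vector_normD(2)[OF assms(1), of 0] signal_norm_nonneg[OF assms(2)]
      in \<open>auto simp: signal_norm_le_iff\<close>)

text \<open>Strict causality: the sum starts at \<open>t = 1\<close>, so the value at
  \<open>k\<close> sees only earlier inputs.\<close>

lemma conv_eq_0: "(\<And>j. j < k \<Longrightarrow> v j = 0) \<Longrightarrow> conv \<Phi> v k = 0"
  unfolding conv_def by (intro sum.neutral) auto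

text \<open>The operator norm speaks of whole signals, but \<open>v\<close> is bounded only before
  \<open>k\<close>. Cutting \<open>v\<close> off at \<open>k\<close> and dividing by
  \<open>b\<close> puts it in the unit ball; by causality the value at \<open>k\<close> changes only
  by the factor \<open>1 / b\<close>.\<close>

lemma norm_conv_le:
  assumes N: "vector_norm N" "vector_norm N'" and a: "operator_norm N N' \<Phi> = ereal a"
    and b: "b \<ge> 0" and v: "\<And>j. j < k \<Longrightarrow> N (v j) \<le> b"
  shows "N' (conv \<Phi> v k) \<le> a * b"
proof (cases "b = 0")
  case True
  then have "conv \<Phi> v k = 0"
    using v vector_normD[OF N(1)] by (intro conv_eq_0) (metis order_antisym)
  then show ?thesis
    using True vector_normD(2)[OF N(2), of 0] by simp
next
  case False
  define v' where "v' j = (if j < k then (1 / b) *\<^sub>R v j else 0)" for j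
  have "N (v' j) \<le> 1" for j
    using False b v[of j] vector_normD(3)[OF N(1)] vector_normD(2)[OF N(1), of 0]
    by (cases "j < k") (auto simp: v'_def divide_simps)
  then have "signal_norm N v' \<le> 1"
    by (simp add: signal_norm_le_iff)
  then have "signal_norm N' (conv \<Phi> v') \<le> a"
    unfolding a[symmetric] operator_norm_def by (intro SUP_upper) simp
  then have "N' (conv \<Phi> v' k) \<le> a"
    by (simp add: signal_norm_le_iff)
  moreover have "conv \<Phi> v' k = (1 / b) *\<^sub>R conv \<Phi> v k"
    unfolding conv_def scaleR_sum_right
    by (intro sum.cong refl) (auto simp: v'_def matrix_vector_mult_scaleR)
  ultimately show ?thesis
    using False b vector_normD(3)[OF N(2)] by (simp add: field_simps)
qed

section \<open>Propagation of the error bound and the small-gain constants\<close>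

text \<open>At distance exactly \<open>r\<close> from \<open>x0\<close> the slope bound makes
  \<open>S * r\<close> an upper bound of a norm. Such a point exists because index types are
  nonempty, so the all-ones vector is nonzero.\<close>

lemma slope_nonneg:
  fixes x0 :: "real^'n"
  assumes "vector_norm N" "vector_norm N'" "r > 0" "locally_slope_bounded N N' S r x0 f"
  shows "S \<ge> 0"
proof -
  define h :: "real^'n" where "h = 1"
  have "N h > 0"
    using vector_normD(1,2)[OF assms(1), of h] by (simp add: h_def order_less_le)
  then have "N ((r / N h) *\<^sub>R h) = r"
    using vector_normD(3)[OF assms(1)] assms(3) by simp
  then have "N' (f (x0 + (r / N h) *\<^sub>R h) - f x0) \<le> S * r"
    using assms(4)[unfolded locally_slope_bounded_def nball_def,
        THEN bspec[of _ _ "x0 + (r / N h) *\<^sub>R h"]] by simp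
  then have "0 \<le> S * r"
    using vector_normD(1)[OF assms(2)] order_trans by blast
  with assms(3) show ?thesis
    by (simp add: zero_le_mult_iff)
qed

text \<open>The invariant is \<open>Ne (e k) \<le> g\<close>; it propagates because \<open>x k\<close> depends only on the
  errors before time \<open>k\<close>.\<close>

lemma perception_error_induction:
  assumes N: "vector_norm Nx" "vector_norm Ne"
    and state: "\<And>k. x k = y k + conv \<Phi> e k"
    and close: "\<And>k. Nx (y k - xd k) \<le> c"
    and gain: "\<And>k. (\<And>j. j < k \<Longrightarrow> Ne (e j) \<le> g) \<Longrightarrow> Nx (conv \<Phi> e k) \<le> d"
    and radius: "c + d \<le> r" and invariant: "S * (c + d) + R0 \<le> g" and S: "S \<ge> 0"
    and slope: "\<And>k. locally_slope_bounded Nx Ne S r (xd k) f"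
    and error: "\<And>k. e k = f (x k)" and training: "\<And>k. Ne (f (xd k)) \<le> R0"
  shows "Nx (x k - xd k) \<le> c + d \<and> Ne (e k) \<le> g"
proof (induction k rule: less_induct)
  case (less k)
  have "Nx (x k - xd k) \<le> Nx (y k - xd k) + Nx (conv \<Phi> e k)"
    using vector_normD(4)[OF N(1), of "y k - xd k" "conv \<Phi> e k"]
    by (simp add: state algebra_simps)
  also have "\<dots> \<le> c + d"
    using close gain less by (intro add_mono) auto
  finally have dist: "Nx (x k - xd k) \<le> c + d" .
  have "Ne (e k) \<le> Ne (f (x k) - f (xd k)) + Ne (f (xd k))"
    using vector_normD(4)[OF N(2), of "f (x k) - f (xd k)" "f (xd k)"] by (simp add: error)
  \<comment> \<open>The bound \<open>c + d \<le> r\<close> places \<open>x k\<close> in the ball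
    around \<open>xd k\<close> where the slope bound is available.\<close>
  also have "\<dots> \<le> S * Nx (x k - xd k) + R0"
    using slope[of k] dist radius training
    by (intro add_mono) (auto simp: locally_slope_bounded_def nball_def)
  also have "\<dots> \<le> S * (c + d) + R0"
    using dist S by (intro add_right_mono mult_left_mono)
  finally show ?case
    using dist invariant by simp
qed

text \<open>The degenerate cases \<open>d = 0 \<and> g = 0\<close> are \<open>S = R0 = 0\<close>, where division by \<open>0\<close> in
  \<open>small\<close> allows \<open>phi = \<infinity>\<close>, and \<open>S * phi = 1\<close>, where \<open>\<gamma> = 0 / 0 = 0\<close>.\<close>

lemma small_gain_constants:
  fixes c phi :: ereal
  assumes nonneg: "c \<ge> 0" "phi \<ge> 0" "S \<ge> 0" "R0 \<ge> 0" "r > 0"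
    and small: "phi \<le> (1 - ereal (1 / r) * c) / ereal (S + R0 / r)"
  obtains c' g d where "c = ereal c'" "g \<ge> 0" "c' + d \<le> r" "S * (c' + d) + R0 \<le> g"
    "ereal g \<le> (ereal S * c + ereal R0) / (1 - ereal S * phi)"
    "S \<le> 1 \<longrightarrow> ereal g \<le> (c + ereal R0) / (1 - ereal S * phi)"
    "d = 0 \<and> g = 0 \<or> (\<exists>a. phi = ereal a \<and> d = a * g)"
proof -
  \<comment> \<open>Otherwise the bound on \<open>phi\<close> is \<open>-\<infinity>\<close>, even
    for denominator 0, since dividing by 0 in \<open>ereal\<close> multiplies by
    \<open>\<infinity>\<close>.\<close>
  have "c \<noteq> \<infinity>"
  proof
    assume "c = \<infinity>"
    then have "1 - ereal (1 / r) * c = - \<infinity>"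
      using nonneg by (simp add: one_ereal_def)
    moreover have "S + R0 / r \<ge> 0"
      using nonneg by simp
    ultimately have "(1 - ereal (1 / r) * c) / ereal (S + R0 / r) = - \<infinity>"
      by (simp add: divide_ereal_def order_less_le)
    with small nonneg show False
      by simp
  qed
  then obtain c' where c: "c = ereal c'" and c': "c' \<ge> 0"
    using nonneg(1) by (cases c) auto
  have num: "1 - ereal (1 / r) * c = ereal (1 - c' / r)"
    by (simp add: c one_ereal_def)
  show thesis
  proof (cases "S = 0 \<and> R0 = 0")
    case True
    \<comment> \<open>The denominator is 0, so a negative numerator would again give
      \<open>-\<infinity>\<close>.\<close>
    have "c' \<le> r"
    proof (rule ccontr)
      assume "\<not> c' \<le> r"
      then have "1 - c' / r < 0" using nonneg(5) by simp
      then have "(1 - ereal (1 / r) * c) / ereal (S + R0 / r) = - \<infinity>"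
        using True \<open>\<not> c' \<le> r\<close> by (simp add: num divide_ereal_def)
      with small nonneg show False by simp
    qed
    then show thesis
      using True c c' by (intro that[of c' 0 0]) (auto simp flip: zero_ereal_def)
  next
    case False
    then have pos: "S + R0 / r > 0"
      using nonneg by (metis add_nonneg_pos add_pos_nonneg divide_nonneg_pos divide_pos_pos order_less_le)
    have "phi \<le> ereal ((1 - c' / r) / (S + R0 / r))"
      using small pos by (simp add: num)
    then obtain a where phi: "phi = ereal a" and a: "a \<ge> 0" "a \<le> (1 - c' / r) / (S + R0 / r)"
      using nonneg by (cases phi) auto
    have "a * (S + R0 / r) \<le> 1 - c' / r"
      using a pos by (simp add: pos_le_divide_eq)
    \<comment> \<open>The small-gain condition cleared of denominators. It gives
      \<open>1 - S * a \<ge> 0\<close>, forces \<open>c' = R0 = 0\<close> when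
      \<open>S * a = 1\<close>, and otherwise yields the radius bound.\<close>
    then have key: "c' + a * R0 \<le> r * (1 - S * a)"
    proof -
      have "a * (S * r + R0) / r \<le> (r - c') / r"
        using \<open>a * (S + R0 / r) \<le> 1 - c' / r\<close> nonneg(5) by (simp add: add_divide_eq_iff diff_divide_distrib)
      then show ?thesis
        using nonneg(5) by (simp add: divide_le_cancel algebra_simps)
    qed
    have den: "1 - ereal S * phi = ereal (1 - S * a)"
      by (simp add: phi one_ereal_def)
    show thesis
    proof (cases "S * a = 1")
      case True
      then have "a > 0" using a by (metis less_eq_real_def mult_zero_right zero_neq_one)
      then have "a * R0 \<ge> 0" "c' + a * R0 \<le> 0"
        using key True nonneg(4) by simp_all
      then have "c' = 0" "a * R0 = 0"
        using c' by linarith+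
      then have "c' = 0" "R0 = 0"
        using \<open>a > 0\<close> by simp_all
      then show thesis
        using True c nonneg by (intro that[of c' 0 0]) (auto simp: den simp flip: zero_ereal_def)
    next
      case False
      have "0 \<le> r * (1 - S * a)" using key c' a nonneg by (meson add_nonneg_nonneg mult_nonneg_nonneg order_trans)
      with False nonneg have D: "1 - S * a > 0" by (simp add: zero_le_mult_iff)
      \<comment> \<open>The solution of \<open>g = S * (c' + a * g) + R0\<close>, the
        self-consistent error bound.\<close>
      define g where "g = (S * c' + R0) / (1 - S * a)"
      have "c' + a * g = (c' + a * R0) / (1 - S * a)"
        using D by (simp add: g_def field_simps)
      also have "\<dots> \<le> r"
        using key D by (simp add: pos_divide_le_eq)
      finally have r: "c' + a * g \<le> r" .
      have inv: "S * (c' + a * g) + R0 = g"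
        using D by (simp add: g_def field_simps)
      have g2: "g \<le> (c' + R0) / (1 - S * a)" if "S \<le> 1"
        unfolding g_def using D c' that by (intro divide_right_mono) (auto simp: mult_left_le_one_le nonneg)
      have quot: "ereal y / (1 - ereal S * phi) = ereal (y / (1 - S * a))" for y
        using D by (simp add: den)
      have "ereal g \<le> (ereal S * c + ereal R0) / (1 - ereal S * phi)"
        by (simp only: c times_ereal.simps plus_ereal.simps quot g_def order_refl)
      moreover have "ereal g \<le> (c + ereal R0) / (1 - ereal S * phi)" if "S \<le> 1"
        using g2[OF that] by (simp only: c plus_ereal.simps quot ereal_less_eq(3))
      moreover have "g \<ge> 0"
        using D c' nonneg by (simp add: g_def)
      ultimately show thesis
        using r inv phi by (intro that[of c' g "a * g"]) (auto simp: c)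
    qed
  qed
qed

section \<open>Error bound and safety of the closed loop\<close>

text \<open>The self-consistent bound has numerator \<open>S * closeness + R0\<close>. The numerator
  \<open>closeness + R0\<close> dominates it when \<open>S \<le> 1\<close>, hence the guard on the
  second conjunct.\<close>

theorem theorem4p2:
  fixes A :: "real^'n^'n" and B :: "real^'m^'n" and H :: "real^'d^'n" and C :: "real^'n^'l"
    and q :: "real^'n \<Rightarrow> real^'k" and p :: "real^'k \<Rightarrow> real^'l"
    and Nx :: "real^'n \<Rightarrow> real" and Ne :: "real^'l \<Rightarrow> real"
    and S0 :: "((real^'n) \<times> (real^'k)) set"
    and S r R0 :: real
    and \<Phi>xw :: "nat \<Rightarrow> real^'n^'n" and \<Phi>xe :: "nat \<Rightarrow> real^'l^'n"
    and \<Phi>uw :: "nat \<Rightarrow> real^'n^'m" and \<Phi>ue :: "nat \<Rightarrow> real^'l^'m"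
    and x xd :: "nat \<Rightarrow> real^'n" and u :: "nat \<Rightarrow> real^'m" and w :: "nat \<Rightarrow> real^'d"
    and z :: "nat \<Rightarrow> real^'k" and e :: "nat \<Rightarrow> real^'l"
    and closeness phi :: ereal
  assumes norms: "vector_norm Nx" "vector_norm Ne"
    and radius: "r > 0"
    and training_data: "finite S0" "\<forall>(xi, zi)\<in>S0. zi = q xi"
    and slope: "\<forall>(xi, zi)\<in>S0. locally_slope_bounded Nx Ne S r xi (\<lambda>v. p (q v) - C *v v)"
    and responses:
      "vcat (hcat (ztrans \<Phi>xw) (ztrans \<Phi>xe)) (hcat (ztrans \<Phi>uw) (ztrans \<Phi>ue))
         \<in> affine_space A B C"
    and initial: "x 0 = 0"
    and dynamics: "\<forall>k. x (Suc k) = A *v x k + B *v u k + H *v w k"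
    and observations: "\<forall>k. z k = q (x k)"
    and control:
      "ztrans_signal u = controller \<Phi>xw \<Phi>xe \<Phi>uw \<Phi>ue *v ztrans_signal (\<lambda>k. p (z k))"
    and errors: "\<forall>k. e k = p (z k) - C *v x k"
    and training_error: "\<forall>(xi, zi)\<in>S0. Ne (p zi - C *v xi) \<le> R0"
    and target: "\<forall>k. xd k \<in> fst ` S0"
    and closeness: "closeness = signal_norm Nx (\<lambda>k. conv \<Phi>xw (\<lambda>j. H *v w j) k - xd k)"
    and phi: "phi = operator_norm Ne Nx \<Phi>xe"
    and small: "phi \<le> (1 - ereal (1 / r) * closeness) / ereal (S + R0 / r)"
  shows
    "(let \<gamma> = (ereal S * closeness + ereal R0) / (1 - ereal S * phi) in
        signal_norm Ne e \<le> \<gamma> \<and> (\<forall>k. x k \<in> safe_set Nx Ne p C S0 S r \<gamma>))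
     \<and> (S \<le> 1 \<longrightarrow>
        (let \<gamma> = (closeness + ereal R0) / (1 - ereal S * phi) in
           signal_norm Ne e \<le> \<gamma> \<and> (\<forall>k. x k \<in> safe_set Nx Ne p C S0 S r \<gamma>)))"
proof -
  \<comment> \<open>The perception error as a function of the state alone.\<close>
  define f where "f v = p (q v) - C *v v" for v
  have data: "\<exists>zd. (xd k, zd) \<in> S0 \<and> zd = q (xd k)" for k
    using target training_data(2) by fastforce
  have slope': "locally_slope_bounded Nx Ne S r (xd k) f" for k
    using data[of k] slope unfolding f_def by fast
  have training: "Ne (f (xd k)) \<le> R0" for k
    using data[of k] training_error unfolding f_def by fast
  have S: "S \<ge> 0"
    using slope_nonneg[OF norms radius slope'] .
  have R0: "R0 \<ge> 0"
    using training[of 0] vector_normD(1)[OF norms(2)] order_trans by blast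
  have "closeness \<ge> 0" "phi \<ge> 0"
    by (simp_all add: closeness phi norms signal_norm_nonneg operator_norm_nonneg)
  then obtain c g d where c: "closeness = ereal c" and g: "g \<ge> 0"
    and cd: "c + d \<le> r" "S * (c + d) + R0 \<le> g"
    and gamma: "ereal g \<le> (ereal S * closeness + ereal R0) / (1 - ereal S * phi)"
      "S \<le> 1 \<longrightarrow> ereal g \<le> (closeness + ereal R0) / (1 - ereal S * phi)"
    and d: "d = 0 \<and> g = 0 \<or> (\<exists>a. phi = ereal a \<and> d = a * g)"
    using small_gain_constants[OF _ _ S R0 radius small] by metis
  have state: "x k = conv \<Phi>xw (\<lambda>j. H *v w j) k + conv \<Phi>xe e k" for k
    using responses initial dynamics control
    by (intro closed_loop_state[where A = A and B = B and C = C and u = u]) (auto simp: errors)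
  have close: "Nx (conv \<Phi>xw (\<lambda>j. H *v w j) k - xd k) \<le> c" for k
    using c unfolding closeness by (metis ereal_less_eq(3) order_refl signal_norm_le_iff)
  \<comment> \<open>In the degenerate case the earlier errors vanish, so causality gives 0 even if
    \<open>phi\<close> is infinite; otherwise \<open>norm_conv_le\<close> applies.\<close>
  have gain: "Nx (conv \<Phi>xe e k) \<le> d" if "\<And>j. j < k \<Longrightarrow> Ne (e j) \<le> g" for k
    using d
  proof
    assume "d = 0 \<and> g = 0"
    moreover from this have "conv \<Phi>xe e k = 0"
      using that vector_normD[OF norms(2)] by (intro conv_eq_0) (metis order_antisym)
    ultimately show ?thesis
      using vector_normD(2)[OF norms(1), of 0] by simp
  next
    assume "\<exists>a. phi = ereal a \<and> d = a * g"
    then show ?thesis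
      using norm_conv_le[OF norms(2,1) _ g that] phi by auto
  qed
  have bound: "Nx (x k - xd k) \<le> c + d \<and> Ne (e k) \<le> g" for k
    by (rule perception_error_induction[OF norms state close gain cd S slope' _ training])
      (simp_all add: f_def errors observations)
  \<comment> \<open>Stated for any bound above \<open>g\<close>, so that it serves both values of
    \<gamma>.\<close>
  have conclusion: "signal_norm Ne e \<le> \<gamma> \<and> (\<forall>k. x k \<in> safe_set Nx Ne p C S0 S r \<gamma>)"
    if "ereal g \<le> \<gamma>" for \<gamma>
  proof (intro conjI allI)
    show "signal_norm Ne e \<le> \<gamma>"
      using bound that by (auto simp: signal_norm_le_iff intro: order_trans[of _ "ereal g"])
    fix k
    \<comment> \<open>The training pair of the current target state witnesses membership in the safe
      set; its defining sum is bounded by the same invariant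
      \<open>S * (c + d) + R0 \<le> g\<close>.\<close>
    obtain zd where zd: "(xd k, zd) \<in> S0" "zd = q (xd k)"
      using data by blast
    have "Ne (p zd - C *v xd k) + S * Nx (x k - xd k) \<le> R0 + S * (c + d)"
      using training[of k] bound S unfolding zd(2) f_def by (intro add_mono mult_left_mono) auto
    then have "ereal (Ne (p zd - C *v xd k) + S * Nx (x k - xd k)) \<le> ereal g"
      using cd(2) by simp
    then have "ereal (Ne (p zd - C *v xd k) + S * Nx (x k - xd k)) \<le> \<gamma>"
      using that by (rule order_trans)
    moreover have "Nx (x k - xd k) \<le> r"
      using bound[of k] cd(1) by simp
    ultimately show "x k \<in> safe_set Nx Ne p C S0 S r \<gamma>"
      using zd(1) by (auto simp: safe_set_def nball_def)
  qed
  show ?thesis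
    using gamma conclusion by (simp add: Let_def)
qed

end
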